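(* Let $\Pi$ be a probability measure and let $T$ be a $\Pi$-invariant Markov kernel, with $L^2(\Pi)$-adjoint $T^*$. Suppose that $TT^*$ satisfies a $K^*$-weak Poincaré inequality with a given $\mathrm K^*$, i.e. $$\mathrm K^*\!\left(\frac{\|f\|_\Pi^2}{\|f\|_{\mathrm{osc}}^2}\right)\le\frac{\mathcal E_\Pi(TT^*,f)}{\|f\|_{\mathrm{osc}}^2}\qquad\forall f\in L^2_0(\Pi),\ 0<\|f\|_{\mathrm{osc}}<\infty.$$ Then $T^*T$ satisfies a $K^*$-weak Poincaré inequality with $\tilde{\mathrm K}^*(v):=\mathrm K^*(v/2)$, i.e. $$\mathrm K^*\!\left(\frac{\|f\|_\Pi^2}{2\|f\|_{\mathrm{osc}}^2}\right)\le\frac{\mathcal E_\Pi(T^*T,f)}{\|f\|_{\mathrm{osc}}^2}\qquad\forall f\in L^2_0(\Pi),\ 0<\|f\|_{\mathrm{osc}}<\infty.$$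
   Context: $L^2_0(\Pi)$ is the space of mean-zero functions in $L^2(\Pi)$, $\|f\|_\Pi^2=\int f^2d\Pi$, $\|f\|_{\mathrm{osc}}=\operatorname{ess\,sup}_\Pi f-\operatorname{ess\,inf}_\Pi f$. A $\Pi$-invariant Markov kernel $T$ acts by $(Tf)(x)=\int f(x')T(x,dx')$, and $\mathcal E_\Pi(R,f)=\langle (I-R)f,f\rangle_\Pi$ for a Markov operator $R$. The function $\mathrm K^*$ in a $K^*$-weak Poincaré inequality is of the form $\mathrm K^*(v)=\sup_{u\ge0}\{uv-\mathrm K(u)\}$, $v\ge0$, with $\mathrm K(u)=u\,\beta(1/u)$ for $u>0$, $\mathrm K(0)=0$, where $\beta:(0,\infty)\to[0,\infty)$ is decreasing with $\lim_{s\to\infty}\beta(s)=0$; the inequality is equivalent to $\|f\|_\Pi^2\le s\,\mathcal E_\Pi(TT^*,f)+\beta(s)\|f\|_{\mathrm{osc}}^2$ for all $s>0$, $f\in L_0^2(\Pi)$. (Such $\mathrm K^*$ is convex, increasing, $\mathrm K^*(0)=0$, and $v\mapsto v^{-1}\mathrm K^*(v)$ is increasing.) *)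

theory Defs
  imports "HOL-Probability.Probability"
begin

definition invariant_kernel :: "'a measure \<Rightarrow> ('a \<Rightarrow> 'a measure) \<Rightarrow> bool" where
  "invariant_kernel \<mu> T \<longleftrightarrow> T \<in> measurable \<mu> (prob_algebra \<mu>) \<and> \<mu> \<bind> T = \<mu>"

definition kernel_op :: "('a \<Rightarrow> 'a measure) \<Rightarrow> ('a \<Rightarrow> real) \<Rightarrow> 'a \<Rightarrow> real" where
  "kernel_op T f x = (LINT y|T x. f y)"

text \<open>Elements of \<open>L\<^sup>2(\<mu>)\<close> are represented by functions rather than by classes modulo
  almost-everywhere equality.\<close>

definition L2_fun :: "'a measure \<Rightarrow> ('a \<Rightarrow> real) set" where
  "L2_fun \<mu> = {f \<in> borel_measurable \<mu>. integrable \<mu> (\<lambda>x. (f x)\<^sup>2)}"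

definition L2_zero :: "'a measure \<Rightarrow> ('a \<Rightarrow> real) set" where
  "L2_zero \<mu> = {f \<in> L2_fun \<mu>. (LINT x|\<mu>. f x) = 0}"

definition L2_inner :: "'a measure \<Rightarrow> ('a \<Rightarrow> real) \<Rightarrow> ('a \<Rightarrow> real) \<Rightarrow> real" where
  "L2_inner \<mu> f g = (LINT x|\<mu>. f x * g x)"

definition L2_normsq :: "'a measure \<Rightarrow> ('a \<Rightarrow> real) \<Rightarrow> real" where
  "L2_normsq \<mu> f = (LINT x|\<mu>. (f x)\<^sup>2)"

text \<open>The adjoint acts on representatives, so it is determined only up to almost-everywhere
  equality of its values. It need not be given by a kernel.\<close>

definition is_L2_adjoint ::
  "'a measure \<Rightarrow> (('a \<Rightarrow> real) \<Rightarrow> 'a \<Rightarrow> real) \<Rightarrow> (('a \<Rightarrow> real) \<Rightarrow> 'a \<Rightarrow> real) \<Rightarrow> bool" where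
  "is_L2_adjoint \<mu> A B \<longleftrightarrow>
     (\<forall>g\<in>L2_fun \<mu>. B g \<in> L2_fun \<mu>) \<and>
     (\<forall>f\<in>L2_fun \<mu>. \<forall>g\<in>L2_fun \<mu>. L2_inner \<mu> (A f) g = L2_inner \<mu> f (B g))"

definition essinf :: "'a measure \<Rightarrow> ('a \<Rightarrow> ereal) \<Rightarrow> ereal" where
  "essinf \<mu> f = - esssup \<mu> (\<lambda>x. - f x)"

definition osc :: "'a measure \<Rightarrow> ('a \<Rightarrow> real) \<Rightarrow> ereal" where
  "osc \<mu> f = esssup \<mu> (\<lambda>x. ereal (f x)) - essinf \<mu> (\<lambda>x. ereal (f x))"

definition dirichlet_form ::
  "'a measure \<Rightarrow> (('a \<Rightarrow> real) \<Rightarrow> 'a \<Rightarrow> real) \<Rightarrow> ('a \<Rightarrow> real) \<Rightarrow> real" where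
  "dirichlet_form \<mu> R f = L2_inner \<mu> (\<lambda>x. f x - R f x) f"

definition wpi_rate :: "(real \<Rightarrow> real) \<Rightarrow> bool" where
  "wpi_rate \<beta> \<longleftrightarrow>
     (\<forall>s>0. 0 \<le> \<beta> s) \<and> antimono_on {0<..} \<beta> \<and> (\<beta> \<longlongrightarrow> 0) at_top"

definition rate_K :: "(real \<Rightarrow> real) \<Rightarrow> real \<Rightarrow> real" where
  "rate_K \<beta> u = (if u = 0 then 0 else u * \<beta> (1 / u))"

text \<open>The supremum is extended-real valued: it is infinite for large \<open>v\<close> when \<open>\<beta>\<close> is bounded.\<close>

definition rate_K_star :: "(real \<Rightarrow> real) \<Rightarrow> real \<Rightarrow> ereal" where
  "rate_K_star \<beta> v = (SUP u\<in>{0..}. ereal (u * v - rate_K \<beta> u))"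

text \<open>The requirement that \<open>Ks\<close> arises from some \<open>\<beta>\<close> is part of the notion. Only the values
  of \<open>Ks\<close> on \<open>[0,\<infinity>)\<close> matter.\<close>

definition K_star_WPI ::
  "'a measure \<Rightarrow> (('a \<Rightarrow> real) \<Rightarrow> 'a \<Rightarrow> real) \<Rightarrow> (real \<Rightarrow> ereal) \<Rightarrow> bool" where
  "K_star_WPI \<mu> R Ks \<longleftrightarrow>
     (\<exists>\<beta>. wpi_rate \<beta> \<and> (\<forall>v\<ge>0. Ks v = rate_K_star \<beta> v)) \<and>
     (\<forall>f\<in>L2_zero \<mu>. 0 < osc \<mu> f \<and> osc \<mu> f < \<infinity> \<longrightarrow>
        Ks (L2_normsq \<mu> f / (real_of_ereal (osc \<mu> f))\<^sup>2)
          \<le> ereal (dirichlet_form \<mu> R f / (real_of_ereal (osc \<mu> f))\<^sup>2))"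

end

theory Submission
  imports Defs
begin

text \<open>
  Write \<open>N f\<close> for \<open>\<parallel>f\<parallel>\<^sup>2\<close> and \<open>o\<close> for the oscillation of \<open>f\<close>, and let \<open>v = N f / o\<^sup>2\<close> and
  \<open>e = (N f - N (T f)) / o\<^sup>2\<close>, the normalised Dirichlet form of \<open>T\<^sup>*T\<close> at \<open>f\<close>.
  If \<open>e \<ge> v / 2\<close>, then the hypothesis for \<open>f\<close> itself gives \<open>u v - K u \<le> v\<close>, hence
  \<open>u v / 2 - K u \<le> v / 2 \<le> e\<close>.  Otherwise \<open>N (T f) > N f / 2\<close>, and the hypothesis is applied to
  \<open>T f\<close>, whose oscillation is at most that of \<open>f\<close> and whose Dirichlet form for \<open>T T\<^sup>*\<close>
  is bounded by that of \<open>T\<^sup>*T\<close> at \<open>f\<close>, since the difference is \<open>N (f - T\<^sup>*T f)\<close>.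
\<close>

section \<open>Rate functions\<close>

lemma wpi_rate_K_nonneg:
  assumes "wpi_rate \<beta>" "0 \<le> u"
  shows "0 \<le> rate_K \<beta> u"
  using assms by (auto simp: wpi_rate_def rate_K_def)

text \<open>Trades the extended-real supremum for real inequalities, one for each \<open>u\<close>,
  so a possibly infinite \<open>rate_K_star\<close> never has to be computed with.\<close>

lemma rate_K_star_le_iff:
  "rate_K_star \<beta> v \<le> ereal e \<longleftrightarrow> (\<forall>u\<ge>0. u * v - rate_K \<beta> u \<le> e)"
  by (auto simp: rate_K_star_def SUP_le_iff)

text \<open>Used with \<open>q\<close> a squared oscillation. Once the denominator is cleared,
  \<open>q\<close> occurs only as a factor of the subtracted \<open>k\<close>, so for
  \<open>k\<close> nonnegative it may be enlarged.\<close>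

lemma scaled_difference_le_iff:
  fixes q :: real
  assumes "0 < q"
  shows "u * v / q - k \<le> e / q \<longleftrightarrow> u * v - k * q \<le> e"
  using assms by (simp add: pos_le_divide_eq left_diff_distrib)

lemma wpi_rate_rescale:
  assumes "wpi_rate \<beta>"
  shows "wpi_rate (\<lambda>s. 2 * \<beta> (s / 2))"
proof -
  have "((\<lambda>s. \<beta> (s / 2)) \<longlongrightarrow> 0) at_top"
  proof (rule filterlim_compose[of \<beta>])
    show "(\<beta> \<longlongrightarrow> 0) at_top" using assms by (simp add: wpi_rate_def)
    show "LIM s at_top. s / 2 :> (at_top :: real filter)"
      using filterlim_tendsto_pos_mult_at_top[OF tendsto_const[of "1/2::real"] _ filterlim_ident]
      by simp
  qed
  from tendsto_mult_right_zero[OF this, of 2]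
  show ?thesis
    using assms by (auto simp: wpi_rate_def monotone_on_def)
qed

text \<open>Substituting \<open>u / 2\<close> for \<open>u\<close> in the supremum moves the factor
  1/2 from \<open>v\<close> to the rate: the new \<open>rate_K\<close> at \<open>u / 2\<close> is
  the old one at \<open>u\<close>.\<close>

lemma rate_K_star_rescale:
  "rate_K_star (\<lambda>s. 2 * \<beta> (s / 2)) v = rate_K_star \<beta> (v / 2)"
proof -
  have img: "(\<lambda>u. u / 2) ` {0..} = {0::real..}"
  proof (intro equalityI subsetI)
    fix u :: real assume "u \<in> {0..}"
    then show "u \<in> (\<lambda>u. u / 2) ` {0..}" by (intro image_eqI[of _ _ "2 * u"]) auto
  qed auto
  have eq: "u / 2 * v - rate_K (\<lambda>s. 2 * \<beta> (s / 2)) (u / 2) = u * (v / 2) - rate_K \<beta> u" for u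
    by (simp add: rate_K_def)
  have "rate_K_star (\<lambda>s. 2 * \<beta> (s / 2)) v
      = (SUP u\<in>(\<lambda>u. u / 2) ` {0..}. ereal (u * v - rate_K (\<lambda>s. 2 * \<beta> (s / 2)) u))"
    by (simp only: rate_K_star_def img)
  also have "\<dots> = rate_K_star \<beta> (v / 2)"
    by (simp only: image_image eq rate_K_star_def)
  finally show ?thesis .
qed

lemma K_star_WPI_D:
  assumes "K_star_WPI \<mu> R Ks" "f \<in> L2_zero \<mu>" "osc \<mu> f = ereal r" "0 < r"
  shows "Ks (L2_normsq \<mu> f / r\<^sup>2) \<le> ereal (dirichlet_form \<mu> R f / r\<^sup>2)"
proof -
  have "0 < osc \<mu> f \<and> osc \<mu> f < \<infinity>" using assms by simp
  then have "Ks (L2_normsq \<mu> f / (real_of_ereal (osc \<mu> f))\<^sup>2)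
      \<le> ereal (dirichlet_form \<mu> R f / (real_of_ereal (osc \<mu> f))\<^sup>2)"
    using assms(1,2) unfolding K_star_WPI_def by blast
  then show ?thesis by (simp add: assms(3))
qed

section \<open>Oscillation\<close>

lemma osc_bounds:
  fixes f :: "'a \<Rightarrow> real"
  assumes "prob_space \<mu>" "f \<in> borel_measurable \<mu>" "osc \<mu> f < \<infinity>"
  obtains a b where "a \<le> b" "AE x in \<mu>. a \<le> f x \<and> f x \<le> b" "osc \<mu> f = ereal (b - a)"
proof -
  interpret prob_space \<mu> by fact
  define S where "S = esssup \<mu> (\<lambda>x. ereal (f x))"
  define I where "I = esssup \<mu> (\<lambda>x. - ereal (f x))"
  have S: "AE x in \<mu>. ereal (f x) \<le> S" unfolding S_def by (rule esssup_AE)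
  have I: "AE x in \<mu>. - ereal (f x) \<le> I" unfolding I_def by (rule esssup_AE)
  have osc: "osc \<mu> f = S + I"
    by (simp add: osc_def essinf_def S_def I_def minus_ereal_def)
  \<comment> \<open>A real function is nowhere below \<open>-\<infinity>\<close>, and under a
    probability measure \<open>False\<close> cannot hold almost everywhere. Hence a finite sum
    \<open>S + I\<close> forces both terms to be finite.\<close>
  have "S \<noteq> -\<infinity>" "I \<noteq> -\<infinity>" using S I by auto
  with osc assms(3) obtain s i where si: "S = ereal s" "I = ereal i"
    by (cases S; cases I) auto
  have AE: "AE x in \<mu>. - i \<le> f x \<and> f x \<le> s"
    using S I unfolding si by eventually_elim simp
  then have "AE x in \<mu>. - i \<le> s" by eventually_elim simp
  then have "- i \<le> s" by simp
  then show thesis using that[of "- i" s] AE osc si by simp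
qed

lemma osc_le:
  fixes f :: "'a \<Rightarrow> real"
  assumes [measurable]: "f \<in> borel_measurable \<mu>" and "AE x in \<mu>. a \<le> f x \<and> f x \<le> b"
  shows "osc \<mu> f \<le> ereal (b - a)"
proof -
  have "esssup \<mu> (\<lambda>x. ereal (f x)) \<le> ereal b"
    using assms(2) by (intro esssup_I) auto
  moreover have "esssup \<mu> (\<lambda>x. - ereal (f x)) \<le> ereal (- a)"
    using assms(2) by (intro esssup_I) auto
  ultimately have "esssup \<mu> (\<lambda>x. ereal (f x)) + esssup \<mu> (\<lambda>x. - ereal (f x)) \<le> ereal b + ereal (- a)"
    by (rule add_mono)
  then show ?thesis by (simp add: osc_def essinf_def minus_ereal_def)
qed

section \<open>Square-integrable functions\<close>

lemma L2_fun_mult_integrable: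
  assumes "f \<in> L2_fun \<mu>" "g \<in> L2_fun \<mu>"
  shows "integrable \<mu> (\<lambda>x. f x * g x)"
proof (rule Bochner_Integration.integrable_bound)
  show "integrable \<mu> (\<lambda>x. (f x)\<^sup>2 + (g x)\<^sup>2)" using assms by (simp add: L2_fun_def)
  show "(\<lambda>x. f x * g x) \<in> borel_measurable \<mu>"
    using assms by (intro borel_measurable_times) (auto simp: L2_fun_def)
  show "AE x in \<mu>. norm (f x * g x) \<le> norm ((f x)\<^sup>2 + (g x)\<^sup>2)"
  proof (rule AE_I2)
    fix x
    have "2 * (\<bar>f x\<bar> * \<bar>g x\<bar>) \<le> (f x)\<^sup>2 + (g x)\<^sup>2"
      using sum_squares_bound[of "\<bar>f x\<bar>" "\<bar>g x\<bar>"] by simp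
    moreover have "0 \<le> \<bar>f x\<bar> * \<bar>g x\<bar>" by simp
    ultimately have "\<bar>f x\<bar> * \<bar>g x\<bar> \<le> (f x)\<^sup>2 + (g x)\<^sup>2" by linarith
    then show "norm (f x * g x) \<le> norm ((f x)\<^sup>2 + (g x)\<^sup>2)" by (simp add: abs_mult)
  qed
qed

lemma L2_normsq_nonneg: "0 \<le> L2_normsq \<mu> f"
  by (simp add: L2_normsq_def)

lemma L2_inner_self: "L2_inner \<mu> f f = L2_normsq \<mu> f"
  by (simp add: L2_inner_def L2_normsq_def power2_eq_square)

lemma L2_inner_commute: "L2_inner \<mu> f g = L2_inner \<mu> g f"
  by (simp add: L2_inner_def mult.commute)

lemma L2_normsq_diff:
  assumes f: "f \<in> L2_fun \<mu>" and g: "g \<in> L2_fun \<mu>"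
  shows "L2_normsq \<mu> (\<lambda>x. f x - g x) = L2_normsq \<mu> f - 2 * L2_inner \<mu> f g + L2_normsq \<mu> g"
proof -
  have "L2_normsq \<mu> (\<lambda>x. f x - g x) = (\<integral>x. (f x)\<^sup>2 - 2 * (f x * g x) + (g x)\<^sup>2 \<partial>\<mu>)"
    by (simp add: L2_normsq_def power2_diff algebra_simps)
  also have "\<dots> = L2_normsq \<mu> f - 2 * L2_inner \<mu> f g + L2_normsq \<mu> g"
    using L2_fun_mult_integrable[OF f g] f g
    by (simp add: L2_normsq_def L2_inner_def L2_fun_def)
  finally show ?thesis .
qed

lemma dirichlet_form_eq:
  assumes f: "f \<in> L2_fun \<mu>" and g: "R f \<in> L2_fun \<mu>"
  shows "dirichlet_form \<mu> R f = L2_normsq \<mu> f - L2_inner \<mu> (R f) f"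
  using L2_fun_mult_integrable[OF g f] L2_fun_mult_integrable[OF f f]
  by (simp add: dirichlet_form_def L2_normsq_def L2_inner_def left_diff_distrib power2_eq_square)

section \<open>Invariant kernels\<close>

text \<open>Cauchy-Schwarz against the constant 1. The nonnegative integral on the right makes sense
  for every measurable \<open>f\<close>, so it applies under each \<open>T x\<close> without an
  integrability check.\<close>

lemma (in prob_space) expectation_square_le_nn_integral:
  assumes [measurable]: "f \<in> borel_measurable M"
  shows "ennreal ((\<integral>x. f x \<partial>M)\<^sup>2) \<le> (\<integral>\<^sup>+x. ennreal ((f x)\<^sup>2) \<partial>M)"
proof (cases "integrable M f")
  case True
  have "ennreal ((\<integral>x. f x \<partial>M)\<^sup>2) = (ennreal (norm (\<integral>x. f x \<partial>M)))\<^sup>2"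
    by (simp add: ennreal_power)
  also have "\<dots> \<le> (\<integral>\<^sup>+x. ennreal (norm (f x)) * 1 \<partial>M)\<^sup>2"
    using integral_norm_bound_ennreal[OF True] by (intro power_mono) auto
  also have "\<dots> \<le> (\<integral>\<^sup>+x. ennreal (norm (f x)) ^ 2 \<partial>M) * (\<integral>\<^sup>+x. 1 ^ 2 \<partial>M)"
    by (intro Cauchy_Schwarz_nn_integral) auto
  also have "\<dots> = (\<integral>\<^sup>+x. ennreal ((f x)\<^sup>2) \<partial>M)"
    by (simp add: ennreal_power emeasure_space_1)
  finally show ?thesis .
\<comment> \<open>For non-integrable \<open>f\<close> the integral on the left is 0 by
  convention.\<close>
qed (simp add: not_integrable_integral_eq)

locale invariant_markov_kernel = prob_space \<mu> for \<mu> :: "'a measure" +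
  fixes T :: "'a \<Rightarrow> 'a measure"
  assumes inv: "invariant_kernel \<mu> T"
begin

lemma kernel_measurable [measurable]: "T \<in> \<mu> \<rightarrow>\<^sub>M subprob_algebra \<mu>"
  using inv by (auto simp: invariant_kernel_def intro: measurable_prob_algebraD)

lemma bind_kernel: "\<mu> \<bind> T = \<mu>"
  using inv by (simp add: invariant_kernel_def)

lemma kernel_prob_space: "x \<in> space \<mu> \<Longrightarrow> prob_space (T x)"
  using inv by (auto simp: invariant_kernel_def space_prob_algebra dest: measurable_space)

lemma kernel_sets: "x \<in> space \<mu> \<Longrightarrow> sets (T x) = sets \<mu>"
  using sets_kernel[OF kernel_measurable] .

lemma kernel_borel_measurable:
  "x \<in> space \<mu> \<Longrightarrow> f \<in> borel_measurable \<mu> \<Longrightarrow> f \<in> borel_measurable (T x)"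
  by (simp cong: measurable_cong_sets add: kernel_sets)

lemma kernel_op_measurable:
  assumes [measurable]: "f \<in> borel_measurable \<mu>"
  shows "kernel_op T f \<in> borel_measurable \<mu>"
  unfolding kernel_op_def[abs_def]
  by (rule measurable_compose[OF kernel_measurable integral_measurable_subprob_algebra]) fact

text \<open>The square of the mean is bounded by the mean of the square under each
  \<open>T x\<close>; integrating over \<open>\<mu>\<close> then gives back \<open>\<mu>\<close> by
  invariance.\<close>

lemma kernel_op_L2:
  assumes f: "f \<in> L2_fun \<mu>"
  shows "kernel_op T f \<in> L2_fun \<mu>"
proof -
  have [measurable]: "f \<in> borel_measurable \<mu>" using f by (simp add: L2_fun_def)
  have [measurable]: "kernel_op T f \<in> borel_measurable \<mu>" by (rule kernel_op_measurable) fact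
  have "(\<integral>\<^sup>+x. ennreal ((kernel_op T f x)\<^sup>2) \<partial>\<mu>) \<le> (\<integral>\<^sup>+x. \<integral>\<^sup>+y. ennreal ((f y)\<^sup>2) \<partial>T x \<partial>\<mu>)"
    unfolding kernel_op_def
    by (intro nn_integral_mono prob_space.expectation_square_le_nn_integral
        kernel_prob_space kernel_borel_measurable) auto
  also have "\<dots> = (\<integral>\<^sup>+y. ennreal ((f y)\<^sup>2) \<partial>(\<mu> \<bind> T))"
    by (rule nn_integral_bind[symmetric, where B=\<mu>]) auto
  also have "\<dots> < \<infinity>"
    using f unfolding bind_kernel L2_fun_def integrable_iff_bounded by simp
  finally have "integrable \<mu> (\<lambda>x. (kernel_op T f x)\<^sup>2)"
    by (intro integrableI_bounded) auto
  then show ?thesis by (simp add: L2_fun_def)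
qed

text \<open>Invariance makes a \<open>\<mu>\<close>-null set null for almost every
  \<open>T x\<close>, so \<open>kernel_op\<close> respects almost-everywhere equality and
  almost-everywhere bounds.\<close>

lemma AE_kernel:
  assumes "AE x in \<mu>. P x" and [measurable]: "Measurable.pred \<mu> P"
  shows "AE x in \<mu>. AE y in T x. P y"
  using AE_bind[OF kernel_measurable assms(2)] assms(1) unfolding bind_kernel by blast

text \<open>Averages stay between the essential bounds; this is why the kernel does not increase
  oscillation.\<close>

lemma kernel_op_bounds:
  assumes [measurable]: "f \<in> borel_measurable \<mu>" and "AE x in \<mu>. a \<le> f x \<and> f x \<le> b"
  shows "AE x in \<mu>. a \<le> kernel_op T f x \<and> kernel_op T f x \<le> b"
proof -
  have "AE x in \<mu>. AE y in T x. a \<le> f y \<and> f y \<le> b"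
    by (rule AE_kernel[OF assms(2)]) measurable
  moreover have "AE x in \<mu>. x \<in> space \<mu>" by simp
  ultimately show ?thesis
  proof eventually_elim
    case (elim x)
    interpret Tx: prob_space "T x" by (rule kernel_prob_space) fact
    have [measurable]: "f \<in> borel_measurable (T x)" using elim by (intro kernel_borel_measurable) auto
    have int: "integrable (T x) f"
      using elim(1) by (intro Tx.integrable_const_bound[where B="max \<bar>a\<bar> \<bar>b\<bar>"]) auto
    have lo: "AE y in T x. a \<le> f y" and hi: "AE y in T x. f y \<le> b" using elim(1) by auto
    show ?case
      unfolding kernel_op_def using Tx.integral_ge_const[OF int lo] Tx.integral_le_const[OF int hi]
      by simp
  qed
qed

lemma integral_kernel_op:
  assumes [measurable]: "f \<in> borel_measurable \<mu>" and bd: "AE x in \<mu>. a \<le> f x \<and> f x \<le> b" and "a \<le> b"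
  shows "(\<integral>x. kernel_op T f x \<partial>\<mu>) = (\<integral>x. f x \<partial>\<mu>)"
proof -
  \<comment> \<open>The truncation equals \<open>f\<close> almost everywhere but is bounded at every
    point, so its integral over \<open>\<mu> \<bind> T\<close> can be written as an iterated
    integral.\<close>
  define g where "g = (\<lambda>x. max a (min b (f x)))"
  have [measurable]: "g \<in> borel_measurable \<mu>" by (simp add: g_def)
  have fg: "AE x in \<mu>. f x = g x" using bd by eventually_elim (auto simp: g_def)
  have AE: "AE x in \<mu>. AE y in T x. f y = g y" by (rule AE_kernel[OF fg]) measurable
  have "AE x in \<mu>. kernel_op T f x = kernel_op T g x"
    using AE AE_space
    by eventually_elim (auto simp: kernel_op_def kernel_borel_measurable intro!: integral_cong_AE)
  then have "(\<integral>x. kernel_op T f x \<partial>\<mu>) = (\<integral>x. kernel_op T g x \<partial>\<mu>)"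
    by (intro integral_cong_AE kernel_op_measurable) auto
  also have "\<dots> = (\<integral>x. g x \<partial>(\<mu> \<bind> T))"
    unfolding kernel_op_def
    by (rule integral_bind[symmetric, where K=\<mu> and B="max \<bar>a\<bar> \<bar>b\<bar>" and B'=1])
      (auto simp: g_def prob_space.emeasure_space_1 kernel_prob_space)
  also have "\<dots> = (\<integral>x. f x \<partial>\<mu>)"
    unfolding bind_kernel using fg by (intro integral_cong_AE) auto
  finally show ?thesis .
qed

end

section \<open>Dirichlet forms of the two products\<close>

locale kernel_with_adjoint = invariant_markov_kernel +
  fixes T_adj :: "('a \<Rightarrow> real) \<Rightarrow> 'a \<Rightarrow> real"
  assumes adj: "is_L2_adjoint \<mu> (kernel_op T) T_adj"
begin

lemma adj_L2: "g \<in> L2_fun \<mu> \<Longrightarrow> T_adj g \<in> L2_fun \<mu>"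
  using adj by (simp add: is_L2_adjoint_def)

lemma inner_adj:
  "f \<in> L2_fun \<mu> \<Longrightarrow> g \<in> L2_fun \<mu> \<Longrightarrow> L2_inner \<mu> (kernel_op T f) g = L2_inner \<mu> f (T_adj g)"
  using adj by (simp add: is_L2_adjoint_def)

lemma dirichlet_form_kernel_adj:
  assumes "f \<in> L2_fun \<mu>"
  shows "dirichlet_form \<mu> (kernel_op T \<circ> T_adj) f = L2_normsq \<mu> f - L2_normsq \<mu> (T_adj f)"
  using assms by (simp add: dirichlet_form_eq kernel_op_L2 adj_L2 inner_adj L2_inner_self)

lemma dirichlet_form_adj_kernel:
  assumes f: "f \<in> L2_fun \<mu>"
  shows "dirichlet_form \<mu> (T_adj \<circ> kernel_op T) f = L2_normsq \<mu> f - L2_normsq \<mu> (kernel_op T f)"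
  using inner_adj[OF f kernel_op_L2[OF f]] f
  by (simp add: dirichlet_form_eq kernel_op_L2 adj_L2 L2_inner_self L2_inner_commute[of _ f])

lemma dirichlet_form_kernel_op_le:
  assumes f: "f \<in> L2_fun \<mu>"
  shows "dirichlet_form \<mu> (kernel_op T \<circ> T_adj) (kernel_op T f)
    \<le> dirichlet_form \<mu> (T_adj \<circ> kernel_op T) f"
proof -
  let ?g = "kernel_op T f"
  have g: "?g \<in> L2_fun \<mu>" by (rule kernel_op_L2[OF f])
  have "0 \<le> L2_normsq \<mu> (\<lambda>x. f x - T_adj ?g x)" by (rule L2_normsq_nonneg)
  \<comment> \<open>By adjointness the cross term, the inner product of \<open>f\<close> and
    \<open>T_adj ?g\<close>, is \<open>L2_normsq \<mu> ?g\<close>.\<close>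
  also have "\<dots> = L2_normsq \<mu> f - 2 * L2_normsq \<mu> ?g + L2_normsq \<mu> (T_adj ?g)"
    using inner_adj[OF f g] by (simp add: L2_normsq_diff[OF f adj_L2[OF g]] L2_inner_self)
  finally show ?thesis
    by (simp add: dirichlet_form_kernel_adj[OF g] dirichlet_form_adj_kernel[OF f])
qed

text \<open>The inequality for \<open>T f\<close> holds with the larger oscillation of \<open>f\<close>, also in the degenerate
  case \<open>T f = 0\<close>, which the hypothesis does not cover.\<close>

lemma K_star_WPI_kernel_op:
  assumes wpi: "K_star_WPI \<mu> (kernel_op T \<circ> T_adj) Ks"
    and \<beta>: "wpi_rate \<beta>" "\<And>v. 0 \<le> v \<Longrightarrow> Ks v = rate_K_star \<beta> v"
    and f: "f \<in> L2_zero \<mu>" and osc: "osc \<mu> f = ereal r" and u: "0 \<le> u"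
  shows "u * L2_normsq \<mu> (kernel_op T f) - rate_K \<beta> u * r\<^sup>2
    \<le> dirichlet_form \<mu> (T_adj \<circ> kernel_op T) f"
proof -
  let ?g = "kernel_op T f"
  have f2: "f \<in> L2_fun \<mu>" and f0: "(\<integral>x. f x \<partial>\<mu>) = 0" using f by (auto simp: L2_zero_def)
  have fm: "f \<in> borel_measurable \<mu>" using f2 by (simp add: L2_fun_def)
  have g2: "?g \<in> L2_fun \<mu>" by (rule kernel_op_L2[OF f2])
  have gm: "?g \<in> borel_measurable \<mu>" using g2 by (simp add: L2_fun_def)
  obtain a b where ab: "a \<le> b" "AE x in \<mu>. a \<le> f x \<and> f x \<le> b" "osc \<mu> f = ereal (b - a)"
    using osc_bounds[OF prob_space_axioms fm] osc by auto
  have g0: "(\<integral>x. ?g x \<partial>\<mu>) = 0" using integral_kernel_op[OF fm ab(2,1)] f0 by simp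
  have og: "osc \<mu> ?g \<le> ereal r"
    using osc_le[OF gm kernel_op_bounds[OF fm ab(2)]] ab(3) osc by simp
  then have "osc \<mu> ?g < \<infinity>" by auto
  then obtain c d where cd: "c \<le> d" "AE x in \<mu>. c \<le> ?g x \<and> ?g x \<le> d" "osc \<mu> ?g = ereal (d - c)"
    using osc_bounds[OF prob_space_axioms gm] by auto
  have K: "0 \<le> rate_K \<beta> u" by (rule wpi_rate_K_nonneg[OF \<beta>(1) u])
  have le: "d - c \<le> r" using og cd(3) by simp
  have "u * L2_normsq \<mu> ?g - rate_K \<beta> u * (d - c)\<^sup>2
    \<le> dirichlet_form \<mu> (kernel_op T \<circ> T_adj) ?g" (is "_ \<le> ?E")
  proof (cases "c = d")
    \<comment> \<open>Zero oscillation makes \<open>?g\<close> almost everywhere constant, and its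
      zero mean makes that constant 0, so both sides vanish.\<close>
    case True
    have "AE x in \<mu>. ?g x = c" using cd(2) by eventually_elim (simp add: True)
    moreover from this have "(\<integral>x. ?g x \<partial>\<mu>) = (\<integral>x. c \<partial>\<mu>)"
      using gm by (intro integral_cong_AE) auto
    then have "c = 0" using g0 by (simp add: prob_space)
    ultimately have z: "AE x in \<mu>. ?g x = 0" by simp
    have inner0: "(\<integral>x. h x * ?g x \<partial>\<mu>) = 0" for h
      using z by (intro integral_eq_zero_AE) auto
    have "L2_normsq \<mu> ?g = 0"
      using inner0[of ?g] by (simp add: L2_normsq_def power2_eq_square)
    then show ?thesis
      using inner0 True by (simp add: dirichlet_form_def L2_inner_def)
  next
    case False
    with cd(1) have cd0: "0 < d - c" by simp
    have "Ks (L2_normsq \<mu> ?g / (d - c)\<^sup>2) \<le> ereal (?E / (d - c)\<^sup>2)"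
      using g2 g0 by (intro K_star_WPI_D[OF wpi _ cd(3) cd0]) (simp add: L2_zero_def)
    then have "u * (L2_normsq \<mu> ?g / (d - c)\<^sup>2) - rate_K \<beta> u \<le> ?E / (d - c)\<^sup>2"
      using u by (simp add: \<beta>(2) L2_normsq_nonneg rate_K_star_le_iff)
    then show ?thesis using cd0 by (simp add: scaled_difference_le_iff)
  qed
  \<comment> \<open>Since \<open>rate_K\<close> is nonnegative, replacing the oscillation of
    \<open>?g\<close> by the larger \<open>r\<close> only lowers the left side.\<close>
  moreover have "rate_K \<beta> u * (d - c)\<^sup>2 \<le> rate_K \<beta> u * r\<^sup>2"
    using K le cd(1) by (intro mult_left_mono power_mono) auto
  ultimately show ?thesis
    using dirichlet_form_kernel_op_le[OF f2] by linarith
qed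

end

theorem lemma3p5:
  fixes \<mu> :: "'a measure"
    and T :: "'a \<Rightarrow> 'a measure"
    and T_adj :: "('a \<Rightarrow> real) \<Rightarrow> 'a \<Rightarrow> real"
    and Ks :: "real \<Rightarrow> ereal"
  assumes "prob_space \<mu>"
    and "invariant_kernel \<mu> T"
    and "is_L2_adjoint \<mu> (kernel_op T) T_adj"
    and "K_star_WPI \<mu> (kernel_op T \<circ> T_adj) Ks"
  shows "K_star_WPI \<mu> (T_adj \<circ> kernel_op T) (\<lambda>v. Ks (v / 2))"
proof -
  interpret kernel_with_adjoint \<mu> T T_adj
    using assms(1-3)
    by (simp add: kernel_with_adjoint_def kernel_with_adjoint_axioms_def
        invariant_markov_kernel_def invariant_markov_kernel_axioms_def)
  obtain \<beta> where \<beta>: "wpi_rate \<beta>" "\<And>v. 0 \<le> v \<Longrightarrow> Ks v = rate_K_star \<beta> v"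
    using assms(4) by (auto simp: K_star_WPI_def)
  show ?thesis
    unfolding K_star_WPI_def
  proof (intro conjI ballI impI)
    \<comment> \<open>The witness is \<open>\<lambda>s. 2 * \<beta> (s / 2)\<close>.\<close>
    show "\<exists>\<beta>'. wpi_rate \<beta>' \<and> (\<forall>v\<ge>0. Ks (v / 2) = rate_K_star \<beta>' v)"
      using wpi_rate_rescale[OF \<beta>(1)] \<beta>(2) by (auto simp: rate_K_star_rescale intro!: exI)
  next
    fix f assume f: "f \<in> L2_zero \<mu>" and o: "0 < osc \<mu> f \<and> osc \<mu> f < \<infinity>"
    then obtain r where r: "osc \<mu> f = ereal r" "0 < r" by (cases "osc \<mu> f") auto
    have f2: "f \<in> L2_fun \<mu>" using f by (simp add: L2_zero_def)
    define N where "N = L2_normsq \<mu> f"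
    define E where "E = dirichlet_form \<mu> (T_adj \<circ> kernel_op T) f"
    have N: "0 \<le> N" by (simp add: N_def L2_normsq_nonneg)
    have E: "E = N - L2_normsq \<mu> (kernel_op T f)"
      by (simp add: N_def E_def dirichlet_form_adj_kernel[OF f2])
    have "u * (N / r\<^sup>2 / 2) - rate_K \<beta> u \<le> E / r\<^sup>2" if u: "0 \<le> u" for u
    proof -
      have K: "0 \<le> rate_K \<beta> u" by (rule wpi_rate_K_nonneg[OF \<beta>(1) u])
      have "u * N / 2 - rate_K \<beta> u * r\<^sup>2 \<le> E"
      proof (cases "N / 2 \<le> E")
        case True
        have "Ks (N / r\<^sup>2) \<le> ereal (dirichlet_form \<mu> (kernel_op T \<circ> T_adj) f / r\<^sup>2)"
          unfolding N_def by (rule K_star_WPI_D[OF assms(4) f r])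
        \<comment> \<open>The Dirichlet form of \<open>kernel_op T \<circ> T_adj\<close> at
          \<open>f\<close> is \<open>N\<close> minus the squared norm of
          \<open>T_adj f\<close>.\<close>
        also have "\<dots> \<le> ereal (N / r\<^sup>2)"
          using r(2) L2_normsq_nonneg[of \<mu> "T_adj f"]
          by (simp add: dirichlet_form_kernel_adj[OF f2] N_def divide_right_mono)
        finally have "u * (N / r\<^sup>2) - rate_K \<beta> u \<le> N / r\<^sup>2"
          using u N by (simp add: \<beta>(2) rate_K_star_le_iff)
        then have "u * N - rate_K \<beta> u * r\<^sup>2 \<le> N" using r(2) by (simp add: scaled_difference_le_iff)
        \<comment> \<open>Halving the previous inequality bounds its left side by
          \<open>N / 2\<close>, hence by \<open>E\<close>, but with only half of the
          \<open>rate_K\<close> term; nonnegativity allows the whole term to be subtracted.\<close>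
        moreover have "0 \<le> rate_K \<beta> u * r\<^sup>2" using K by simp
        ultimately show ?thesis using True by linarith
      next
        case False
        \<comment> \<open>As \<open>E\<close> is \<open>N\<close> minus the squared norm of
          \<open>kernel_op T f\<close>, \<open>E < N / 2\<close> leaves more than
          \<open>N / 2\<close> for that norm.\<close>
        then have "u * (N / 2) \<le> u * L2_normsq \<mu> (kernel_op T f)"
          using E u by (intro mult_left_mono) auto
        then show ?thesis
          using K_star_WPI_kernel_op[OF assms(4) \<beta> f r(1) u] by (simp add: E_def)
      qed
      then show ?thesis
        using r(2) scaled_difference_le_iff[of "r\<^sup>2" u "N / 2" "rate_K \<beta> u" E] by simp
    qed
    then show "Ks (L2_normsq \<mu> f / (real_of_ereal (osc \<mu> f))\<^sup>2 / 2)
        \<le> ereal (dirichlet_form \<mu> (T_adj \<circ> kernel_op T) f / (real_of_ereal (osc \<mu> f))\<^sup>2)"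
      using N by (simp add: r(1) \<beta>(2) rate_K_star_le_iff flip: N_def E_def)
  qed
qed

end
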